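(* Let $\mathcal D\subset\mathbb R^d$ be a finite data set and $N\ge 1$. The activation fan $\Sigma_{\mathcal D}(N)$ is the (outer) normal fan of the activation polytope $P_{\mathcal D}(N)$.
   Context: $\Theta(d,N)\cong\mathbb R^{N(d+1)}$ is the space of parameters $\theta=(a_1,\mathbf s_1,\dots,a_N,\mathbf s_N)$, $a_i\in\mathbb R$, $\mathbf s_i\in\mathbb R^d$, and $f_\theta(\mathbf x)=\max_{i\in[N]}(a_i+\langle\mathbf s_i,\mathbf x\rangle)$. A data point $\mathbf p\in\mathcal D$ activates the $i$-th term of $f_\theta$ if $f_\theta(\mathbf p)=a_i+\langle\mathbf s_i,\mathbf p\rangle$. The activation pattern of $(f_\theta,\mathcal D)$ is the bipartite graph on nodes $\mathcal D\sqcup[N]$ with edges $\{\mathbf p i\mid\mathbf p\text{ activates the }i\text{-th term of }f_\theta\}$. For a bipartite graph $G$ on $\mathcal D\sqcup[N]$ the activation cone $C_{\mathcal D}(G)$ is the Euclidean closure of $\{\theta\mid G\text{ is the activation pattern of }(f_\theta,\mathcal D)\}$. The activation fan $\Sigma_{\mathcal D}(N)$ is the set of all (nonempty) activation cones. For $\mathbf p\in\mathbb R^d$ let $\Delta(\mathbf p)=\operatorname{conv}((1,\mathbf p,0,\mathbf 0,\dots,0,\mathbf 0),(0,\mathbf 0,1,\mathbf p,\dots,0,\mathbf 0),\dots,(0,\mathbf 0,0,\mathbf 0,\dots,1,\mathbf p))\subset\mathbb R^{N(d+1)}$, a simplex of dimension $N-1$ ($\mathbf 0$ is the zero vector of $\mathbb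 R^d$). The activation polytope is the Minkowski sum $P_{\mathcal D}(N)=\sum_{\mathbf p\in\mathcal D}\Delta(\mathbf p)$. The outer normal cone of a face $F$ of a polytope $P$ is $\{y\mid\langle z,y\rangle=\max_{x\in P}\langle x,y\rangle\text{ for all }z\in F\}$; the normal fan is the collection of the normal cones of all (nonempty) faces. *)

theory Defs
  imports "HOL-Analysis.Analysis"
begin

text \<open>
  The ambient dimension $d$ and the number of terms $N \ge 1$ are the cardinalities of the
  index types \<open>'d\<close> and \<open>'n\<close>. Component \<open>i\<close> of a parameter is the pair $(a_i, s_i)$, and the
  library inner product on this type is the standard one on $R^{N(d+1)}$.
\<close>

type_synonym ('d, 'n) params = "(real \<times> (real ^ 'd)) ^ 'n"

definition affine_term :: "('d::finite, 'n::finite) params \<Rightarrow> 'n \<Rightarrow> real ^ 'd \<Rightarrow> real" where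
  "affine_term \<theta> i x = fst (\<theta> $ i) + snd (\<theta> $ i) \<bullet> x"

definition max_affine :: "('d::finite, 'n::finite) params \<Rightarrow> real ^ 'd \<Rightarrow> real" where
  "max_affine \<theta> x = (MAX i\<in>UNIV. affine_term \<theta> i x)"

definition activates :: "('d::finite, 'n::finite) params \<Rightarrow> real ^ 'd \<Rightarrow> 'n \<Rightarrow> bool" where
  "activates \<theta> p i \<longleftrightarrow> max_affine \<theta> p = affine_term \<theta> i p"

text \<open>
  A bipartite graph on the fixed node set $D \sqcup [N]$ is given by its set of edges, where the
  edge between \<open>p \<in> D\<close> and the term \<open>i\<close> is the pair \<open>(p, i)\<close>; that is, by a subset of
  \<open>D \<times> UNIV\<close>.
\<close>

definition activation_pattern ::
    "('d::finite, 'n::finite) params \<Rightarrow> (real ^ 'd) set \<Rightarrow> ((real ^ 'd) \<times> 'n) set" where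
  "activation_pattern \<theta> D = {(p, i). p \<in> D \<and> activates \<theta> p i}"

definition activation_cone ::
    "(real ^ 'd) set \<Rightarrow> ((real ^ 'd) \<times> 'n) set \<Rightarrow> ('d::finite, 'n::finite) params set" where
  "activation_cone D G = closure {\<theta>. activation_pattern \<theta> D = G}"

definition activation_fan :: "(real ^ 'd) set \<Rightarrow> ('d::finite, 'n::finite) params set set" where
  "activation_fan D =
     {activation_cone D G | G. G \<subseteq> D \<times> UNIV \<and> (activation_cone D G :: ('d, 'n) params set) \<noteq> {}}"

definition activation_simplex :: "real ^ 'd \<Rightarrow> ('d::finite, 'n::finite) params set" where
  "activation_simplex p = convex hull (range (\<lambda>i. axis i (1, p)))"

text \<open>The sum of sets is the Minkowski sum from \<^theory>\<open>HOL-Library.Set_Algebras\<close>.\<close>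

definition activation_polytope :: "(real ^ 'd) set \<Rightarrow> ('d::finite, 'n::finite) params set" where
  "activation_polytope D = (\<Sum>p\<in>D. activation_simplex p)"

text \<open>
  For a face \<open>F\<close> of \<open>P\<close> we have \<open>F \<subseteq> P\<close>, so the condition below says that the inner
  product \<open>z \<bullet> y\<close> is the maximum of \<open>x \<bullet> y\<close> over \<open>x \<in> P\<close>, for every \<open>z \<in> F\<close>.
\<close>

definition outer_normal_cone :: "'a::real_inner set \<Rightarrow> 'a set \<Rightarrow> 'a set" where
  "outer_normal_cone P F = {y. \<forall>z\<in>F. \<forall>x\<in>P. x \<bullet> y \<le> z \<bullet> y}"

definition normal_fan :: "'a::real_inner set \<Rightarrow> 'a set set" where
  "normal_fan P = {outer_normal_cone P F | F. F face_of P \<and> F \<noteq> {}}"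

end

theory Submission
  imports Defs
begin

text \<open>
  Pairing a parameter \<open>\<theta>\<close> with the generator \<open>axis i (1, p)\<close> of a simplex evaluates the
  \<open>i\<close>-th affine term of \<open>\<theta>\<close> at \<open>p\<close>. The Minkowski sum is the convex hull of the points
  obtained by choosing one term \<open>c p\<close> for every data point \<open>p\<close>, so maximising \<open>\<theta>\<close> over the
  polytope means maximising the terms of \<open>\<theta>\<close> at all data points independently: the maximum is
  \<open>\<Sum>p\<in>D. max_affine \<theta> p\<close>, and the choice \<open>c\<close> attains it exactly when every \<open>p \<in> D\<close> activates
  the term \<open>c p\<close> (lemma \<open>inner_choice_point_eq_iff\<close>). Hence the face on which \<open>y\<close> is maximal is
  spanned by the choices that use only edges of the activation pattern of \<open>y\<close>, and \<open>\<theta>\<close> lies in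
  the normal cone of that face iff the pattern of \<open>y\<close> is contained in that of \<open>\<theta>\<close>
  (lemma \<open>outer_normal_cone_maximal_face\<close>).

  On the other side, the parameters whose pattern contains that of \<open>y\<close> are precisely the closure
  of those with the same pattern as \<open>y\<close>: containment is a closed condition, and moving from
  \<open>\<theta>\<close> a little in the direction \<open>y\<close> keeps the edges shared with \<open>y\<close> and destroys all others
  (lemma \<open>activation_cone_of_pattern\<close>). Since every nonempty face of a polytope is the maximal
  face of some \<open>y\<close>, both fans consist of the same cones.
\<close>

section \<open>Activation cones\<close>

lemma affine_term_le_max_affine: "affine_term \<theta> i p \<le> max_affine \<theta> p"
  unfolding max_affine_def by (rule Max_ge) auto

lemma activates_iff: "activates \<theta> p i \<longleftrightarrow> (\<forall>j. affine_term \<theta> j p \<le> affine_term \<theta> i p)"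
proof -
  have "max_affine \<theta> p = affine_term \<theta> i p" if "\<forall>j. affine_term \<theta> j p \<le> affine_term \<theta> i p"
    unfolding max_affine_def by (rule Max_eqI) (use that in auto)
  then show ?thesis
    unfolding activates_def using affine_term_le_max_affine[of \<theta> _ p] by auto
qed

lemma ex_activates: "\<exists>i. activates \<theta> p i"
proof -
  have "max_affine \<theta> p \<in> range (\<lambda>i. affine_term \<theta> i p)"
    unfolding max_affine_def by (rule Max_in) auto
  then show ?thesis
    unfolding activates_def by auto
qed

lemma affine_term_eq_inner: "affine_term \<theta> i p = axis i (1, p) \<bullet> \<theta>"
  unfolding inner_axis' by (simp add: affine_term_def inner_prod_def inner_commute)

lemma affine_term_add_scaleR:
  "affine_term (\<theta> + e *\<^sub>R y) i p = affine_term \<theta> i p + e * affine_term y i p"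
  by (simp add: affine_term_eq_inner inner_add_right)

lemma closed_pattern_superset:
  "closed {\<theta> :: ('d::finite, 'n::finite) params.
      activation_pattern y D \<subseteq> activation_pattern \<theta> D}"
proof -
  have "{\<theta> :: ('d, 'n) params. activation_pattern y D \<subseteq> activation_pattern \<theta> D} =
      {\<theta>. \<forall>p i j. (p, i) \<in> activation_pattern y D \<longrightarrow> axis j (1, p) \<bullet> \<theta> \<le> axis i (1, p) \<bullet> \<theta>}"
    by (auto simp: activation_pattern_def activates_iff affine_term_eq_inner)
  also have "closed \<dots>"
    by (intro closed_Collect_all closed_Collect_imp closed_Collect_le open_Collect_const
        continuous_intros)
  finally show ?thesis .
qed

text \<open>
  A shared maximal term stays maximal because both summands attain their maximum there. A term
  that is not maximal for \<open>y\<close> is strictly beaten by a term active for \<open>y\<close>, which by the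
  assumption is also maximal for \<open>\<theta>\<close>, so the gap remains strict after the perturbation.
\<close>

lemma activation_pattern_perturb:
  assumes "activation_pattern y D \<subseteq> activation_pattern \<theta> D" "e > 0"
  shows "activation_pattern (\<theta> + e *\<^sub>R y) D = activation_pattern y D"
proof -
  have "activates (\<theta> + e *\<^sub>R y) p i \<longleftrightarrow> activates y p i" if "p \<in> D" for p i
  proof
    assume "activates y p i"
    then have "activates \<theta> p i"
      using assms(1) that by (auto simp: activation_pattern_def)
    with \<open>activates y p i\<close> \<open>e > 0\<close> show "activates (\<theta> + e *\<^sub>R y) p i"
      by (auto simp: activates_iff affine_term_add_scaleR intro!: add_mono)
  next
    assume act: "activates (\<theta> + e *\<^sub>R y) p i"
    obtain j where j: "activates y p j"
      using ex_activates by blast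
    then have "activates \<theta> p j"
      using assms(1) that by (auto simp: activation_pattern_def)
    then have "affine_term \<theta> i p \<le> affine_term \<theta> j p"
      by (simp add: activates_iff)
    moreover have "affine_term \<theta> j p + e * affine_term y j p
        \<le> affine_term \<theta> i p + e * affine_term y i p"
      using act by (simp add: activates_iff affine_term_add_scaleR)
    ultimately have "e * affine_term y j p \<le> e * affine_term y i p"
      by linarith
    then have "affine_term y j p \<le> affine_term y i p"
      using \<open>e > 0\<close> by simp
    with j show "activates y p i"
      by (auto simp: activates_iff intro: order_trans)
  qed
  then show ?thesis
    by (auto simp: activation_pattern_def)
qed

lemma activation_cone_of_pattern:
  "activation_cone D (activation_pattern y D) =
     {\<theta>. activation_pattern y D \<subseteq> activation_pattern \<theta> D}" (is "_ = ?R")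
proof
  show "activation_cone D (activation_pattern y D) \<subseteq> ?R"
    unfolding activation_cone_def
    by (rule closure_minimal[OF _ closed_pattern_superset]) auto
next
  show "?R \<subseteq> activation_cone D (activation_pattern y D)"
  proof
    fix \<theta> assume \<theta>: "\<theta> \<in> ?R"
    define X where "X n = \<theta> + inverse (real (Suc n)) *\<^sub>R y" for n
    have "X \<longlonglongrightarrow> \<theta> + 0 *\<^sub>R y"
      unfolding X_def by (intro tendsto_intros LIMSEQ_inverse_real_of_nat)
    moreover have "activation_pattern (X n) D = activation_pattern y D" for n
      unfolding X_def using \<theta> by (intro activation_pattern_perturb) auto
    ultimately show "\<theta> \<in> activation_cone D (activation_pattern y D)"
      unfolding activation_cone_def closure_sequential by auto
  qed
qed

lemma activation_fan_eq:
  "activation_fan D = range (\<lambda>y. activation_cone D (activation_pattern y D))"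
proof
  show "activation_fan D \<subseteq> range (\<lambda>y. activation_cone D (activation_pattern y D))"
    unfolding activation_fan_def activation_cone_def by (auto simp: closure_eq_empty)
next
  have "activation_pattern y D \<subseteq> D \<times> UNIV" for y
    by (auto simp: activation_pattern_def)
  moreover have "y \<in> activation_cone D (activation_pattern y D)" for y
    by (simp add: activation_cone_of_pattern)
  ultimately show "range (\<lambda>y. activation_cone D (activation_pattern y D)) \<subseteq> activation_fan D"
    unfolding activation_fan_def by blast
qed

section \<open>The activation polytope and its faces\<close>

definition choice_point ::
    "(real ^ 'd) set \<Rightarrow> (real ^ 'd \<Rightarrow> 'n) \<Rightarrow> ('d::finite, 'n::finite) params" where
  "choice_point D c = (\<Sum>p\<in>D. axis (c p) (1, p))"

lemma set_sum_range:
  fixes f :: "'a \<Rightarrow> 'b \<Rightarrow> 'c::comm_monoid_add"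
  assumes "finite A"
  shows "(\<Sum>a\<in>A. range (f a)) = range (\<lambda>c. \<Sum>a\<in>A. f a (c a))"
proof (intro set_eqI iffI)
  fix x assume "x \<in> (\<Sum>a\<in>A. range (f a))"
  then obtain s where s: "x = sum s A" and "\<forall>a\<in>A. s a \<in> range (f a)"
    unfolding set_sum_alt[OF assms] by blast
  then have "\<forall>a\<in>A. \<exists>b. s a = f a b"
    by blast
  then obtain c where "\<forall>a\<in>A. s a = f a (c a)"
    by (rule bchoice[THEN exE])
  then have "x = (\<Sum>a\<in>A. f a (c a))"
    unfolding s by simp
  then show "x \<in> range (\<lambda>c. \<Sum>a\<in>A. f a (c a))"
    by blast
next
  fix x assume "x \<in> range (\<lambda>c. \<Sum>a\<in>A. f a (c a))"
  then obtain c where "x = (\<Sum>a\<in>A. f a (c a))"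
    by blast
  then show "x \<in> (\<Sum>a\<in>A. range (f a))"
    unfolding set_sum_alt[OF assms] by (intro CollectI exI[of _ "\<lambda>a. f a (c a)"]) simp
qed

lemma range_choice_point:
  assumes "finite D"
  shows "range (choice_point D) = (\<Sum>p\<in>D. range (\<lambda>i. axis i (1, p)))"
  unfolding choice_point_def set_sum_range[OF assms] ..

lemma activation_polytope_eq_hull:
  assumes "finite D"
  shows "activation_polytope D = convex hull (range (choice_point D))"
  unfolding activation_polytope_def activation_simplex_def range_choice_point[OF assms]
  by (rule convex_hull_set_sum[symmetric])

lemma finite_range_choice_point:
  assumes "finite D"
  shows "finite (range (choice_point D))"
  unfolding range_choice_point[OF assms]
  using assms by induction (auto intro: finite_set_plus)

lemma inner_choice_point: "choice_point D c \<bullet> \<theta> = (\<Sum>p\<in>D. affine_term \<theta> (c p) p)"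
  by (simp add: choice_point_def inner_sum_left affine_term_eq_inner)

text \<open>
  Each summand is at most the corresponding maximum, so the sums agree only if all summands do.
\<close>

lemma inner_choice_point_eq_iff:
  assumes "finite D"
  shows "choice_point D c \<bullet> \<theta> = (\<Sum>p\<in>D. max_affine \<theta> p) \<longleftrightarrow> (\<forall>p\<in>D. activates \<theta> p (c p))"
proof
  assume "choice_point D c \<bullet> \<theta> = (\<Sum>p\<in>D. max_affine \<theta> p)"
  then have "(\<Sum>p\<in>D. affine_term \<theta> (c p) p) = (\<Sum>p\<in>D. max_affine \<theta> p)"
    by (simp add: inner_choice_point)
  then have "affine_term \<theta> (c p) p = max_affine \<theta> p" if "p \<in> D" for p
    by (rule sum_mono_inv) (use affine_term_le_max_affine that assms in auto)
  then show "\<forall>p\<in>D. activates \<theta> p (c p)"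
    by (simp add: activates_def)
next
  assume "\<forall>p\<in>D. activates \<theta> p (c p)"
  then show "choice_point D c \<bullet> \<theta> = (\<Sum>p\<in>D. max_affine \<theta> p)"
    by (simp add: inner_choice_point activates_def)
qed

lemma choice_point_in_polytope: "finite D \<Longrightarrow> choice_point D c \<in> activation_polytope D"
  by (simp add: activation_polytope_eq_hull hull_inc)

lemma polytope_attains_max_affine:
  fixes \<theta> :: "('d::finite, 'n::finite) params"
  assumes "finite D"
  obtains x where "x \<in> activation_polytope D" "x \<bullet> \<theta> = (\<Sum>p\<in>D. max_affine \<theta> p)"
proof -
  obtain c where "\<And>p. activates \<theta> p (c p)"
    using ex_activates by metis
  then have "choice_point D c \<bullet> \<theta> = (\<Sum>p\<in>D. max_affine \<theta> p)"
    by (simp add: inner_choice_point_eq_iff[OF assms])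
  then show ?thesis
    using that choice_point_in_polytope[OF assms] by blast
qed

lemma polytope_inner_le:
  fixes \<theta> :: "('d::finite, 'n::finite) params"
  assumes "finite D" "x \<in> activation_polytope D"
  shows "x \<bullet> \<theta> \<le> (\<Sum>p\<in>D. max_affine \<theta> p)"
proof -
  have "choice_point D c \<in> {x. \<theta> \<bullet> x \<le> (\<Sum>p\<in>D. max_affine \<theta> p)}" for c
    by (simp add: inner_commute[of \<theta>] inner_choice_point sum_mono affine_term_le_max_affine)
  then have "convex hull (range (choice_point D)) \<subseteq>
      {x. \<theta> \<bullet> x \<le> (\<Sum>p\<in>D. max_affine \<theta> p)}"
    by (intro hull_minimal convex_halfspace_le) auto
  then show ?thesis
    using assms by (auto simp: activation_polytope_eq_hull inner_commute)
qed

text \<open>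
  The level of the hyperplane is the maximum of \<open>y\<close> over the polytope, by the two preceding
  lemmas, so this is the face exposed by \<open>y\<close>.
\<close>

definition maximal_face ::
    "(real ^ 'd) set \<Rightarrow> ('d::finite, 'n::finite) params \<Rightarrow> ('d, 'n) params set" where
  "maximal_face D y = activation_polytope D \<inter> {x. y \<bullet> x = (\<Sum>p\<in>D. max_affine y p)}"

lemma maximal_face_face_of:
  fixes y :: "('d::finite, 'n::finite) params"
  assumes "finite D"
  shows "maximal_face D y face_of activation_polytope D"
  unfolding maximal_face_def
proof (rule face_of_Int_supporting_hyperplane_le)
  show "convex (activation_polytope D :: ('d, 'n) params set)"
    by (simp add: activation_polytope_eq_hull[OF assms])
qed (use polytope_inner_le[OF assms] in \<open>simp add: inner_commute\<close>)

lemma maximal_face_nonempty: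
  assumes "finite D"
  shows "maximal_face D y \<noteq> {}"
proof -
  obtain x where "x \<in> activation_polytope D" "x \<bullet> y = (\<Sum>p\<in>D. max_affine y p)"
    using polytope_attains_max_affine[OF assms] .
  then show ?thesis
    by (auto simp: maximal_face_def inner_commute)
qed

text \<open>
  Faces of polytopes are exposed, and the level of a supporting hyperplane that meets the polytope
  is forced to be the maximum of the linear functional.
\<close>

lemma face_is_maximal_face:
  fixes F :: "('d::finite, 'n::finite) params set"
  assumes "finite D" "F face_of activation_polytope D" "F \<noteq> {}"
  obtains y where "F = maximal_face D y"
proof -
  have "polyhedron (activation_polytope D :: ('d, 'n) params set)"
    unfolding activation_polytope_eq_hull[OF assms(1)]
    by (intro polyhedron_convex_hull finite_range_choice_point assms(1))
  then have "F exposed_face_of activation_polytope D"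
    using assms(2) by (simp add: exposed_face_of_polyhedron)
  then obtain y b where le: "activation_polytope D \<subseteq> {x. y \<bullet> x \<le> b}"
    and F: "F = activation_polytope D \<inter> {x. y \<bullet> x = b}"
    unfolding exposed_face_of_def by blast
  obtain x where "x \<in> activation_polytope D" "x \<bullet> y = (\<Sum>p\<in>D. max_affine y p)"
    using polytope_attains_max_affine[OF assms(1)] .
  then have "(\<Sum>p\<in>D. max_affine y p) \<le> b"
    using le by (auto simp: inner_commute)
  moreover have "b \<le> (\<Sum>p\<in>D. max_affine y p)"
    using \<open>F \<noteq> {}\<close> polytope_inner_le[OF assms(1)] unfolding F by (auto simp: inner_commute)
  ultimately have "b = (\<Sum>p\<in>D. max_affine y p)"
    by (rule antisym[rotated])
  then have "F = maximal_face D y"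
    unfolding F maximal_face_def by simp
  then show ?thesis
    by (rule that)
qed

section \<open>Normal cones\<close>

lemma outer_normal_cone_iff:
  fixes F :: "('d::finite, 'n::finite) params set"
  assumes "finite D" "F \<subseteq> activation_polytope D"
  shows "\<theta> \<in> outer_normal_cone (activation_polytope D) F \<longleftrightarrow>
    (\<forall>z\<in>F. \<theta> \<bullet> z = (\<Sum>p\<in>D. max_affine \<theta> p))"
proof -
  obtain x where x: "x \<in> activation_polytope D" "x \<bullet> \<theta> = (\<Sum>p\<in>D. max_affine \<theta> p)"
    using polytope_attains_max_affine[OF assms(1)] .
  have "(\<forall>x\<in>activation_polytope D. x \<bullet> \<theta> \<le> z \<bullet> \<theta>) \<longleftrightarrow> \<theta> \<bullet> z = (\<Sum>p\<in>D. max_affine \<theta> p)"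
    if "z \<in> F" for z
  proof -
    have "z \<bullet> \<theta> \<le> (\<Sum>p\<in>D. max_affine \<theta> p)"
      using polytope_inner_le assms that by blast
    then show ?thesis
      using x polytope_inner_le[OF assms(1)] by (auto simp: inner_commute[of \<theta>])
  qed
  then show ?thesis
    by (auto simp: outer_normal_cone_def)
qed

text \<open>
  The maximal face of \<open>y\<close> is the convex hull of the choice points it contains, so it suffices to
  compare \<open>\<theta>\<close> and \<open>y\<close> on choices. Conversely, every edge of the pattern of \<open>y\<close> occurs in some
  choice of active terms, because the active terms at the other data points can be picked
  independently.
\<close>

lemma outer_normal_cone_maximal_face:
  fixes y :: "('d::finite, 'n::finite) params"
  assumes "finite D"
  shows "outer_normal_cone (activation_polytope D) (maximal_face D y) =
    {\<theta>. activation_pattern y D \<subseteq> activation_pattern \<theta> D}"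
proof (intro set_eqI iffI)
  fix \<theta> assume \<theta>: "\<theta> \<in> outer_normal_cone (activation_polytope D) (maximal_face D y)"
  have "activates \<theta> p i" if "p \<in> D" and i: "activates y p i" for p i
  proof -
    obtain c0 where c0: "\<And>q. activates y q (c0 q)"
      using ex_activates by metis
    define c where "c = c0(p := i)"
    have "\<forall>q\<in>D. activates y q (c q)"
      using c0 i by (simp add: c_def)
    then have "choice_point D c \<in> maximal_face D y"
      by (simp add: maximal_face_def choice_point_in_polytope[OF assms] inner_commute[of y]
          inner_choice_point_eq_iff[OF assms])
    then have "choice_point D c \<bullet> \<theta> = (\<Sum>p\<in>D. max_affine \<theta> p)"
      using \<theta> outer_normal_cone_iff[OF assms, of "maximal_face D y" \<theta>]
      by (auto simp: maximal_face_def inner_commute)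
    then have "activates \<theta> p (c p)"
      using inner_choice_point_eq_iff[OF assms] \<open>p \<in> D\<close> by blast
    then show ?thesis
      by (simp add: c_def)
  qed
  then show "\<theta> \<in> {\<theta>. activation_pattern y D \<subseteq> activation_pattern \<theta> D}"
    by (auto simp: activation_pattern_def)
next
  fix \<theta> assume \<theta>: "\<theta> \<in> {\<theta>. activation_pattern y D \<subseteq> activation_pattern \<theta> D}"
  let ?H = "{x. \<theta> \<bullet> x = (\<Sum>p\<in>D. max_affine \<theta> p)}"
  obtain S where S: "S \<subseteq> range (choice_point D)" "maximal_face D y = convex hull S"
    using face_of_convex_hull_subset[OF finite_imp_compact[OF finite_range_choice_point[OF assms]]]
      maximal_face_face_of[OF assms, of y] by (metis activation_polytope_eq_hull[OF assms])
  have "S \<subseteq> ?H"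
  proof
    fix v assume "v \<in> S"
    then obtain c where v: "v = choice_point D c"
      using S(1) by blast
    have "v \<in> maximal_face D y"
      using \<open>v \<in> S\<close> by (simp add: S(2) hull_inc)
    then have "\<forall>p\<in>D. activates y p (c p)"
      using inner_choice_point_eq_iff[OF assms, of c y]
      by (simp add: v maximal_face_def inner_commute)
    then have "\<forall>p\<in>D. activates \<theta> p (c p)"
      using \<theta> by (auto simp: activation_pattern_def)
    then show "v \<in> ?H"
      using inner_choice_point_eq_iff[OF assms, of c \<theta>] by (simp add: v inner_commute)
  qed
  then have "maximal_face D y \<subseteq> ?H"
    unfolding S(2) by (intro hull_minimal convex_hyperplane)
  then show "\<theta> \<in> outer_normal_cone (activation_polytope D) (maximal_face D y)"
    using outer_normal_cone_iff[OF assms, of "maximal_face D y" \<theta>]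
    by (auto simp: maximal_face_def)
qed

theorem theorem5p7:
  fixes D :: "(real ^ 'd::finite) set"
  assumes "finite D"
  shows "(activation_fan D :: ('d, 'n::finite) params set set) = normal_fan (activation_polytope D)"
proof -
  have "normal_fan (activation_polytope D :: ('d, 'n) params set) =
      range (\<lambda>y. outer_normal_cone (activation_polytope D) (maximal_face D y))"
  proof
    show "normal_fan (activation_polytope D :: ('d, 'n) params set) \<subseteq>
        range (\<lambda>y. outer_normal_cone (activation_polytope D) (maximal_face D y))"
      unfolding normal_fan_def using face_is_maximal_face[OF assms] by blast
    show "range (\<lambda>y. outer_normal_cone (activation_polytope D) (maximal_face D y)) \<subseteq>
        normal_fan (activation_polytope D :: ('d, 'n) params set)"
      unfolding normal_fan_def
      using maximal_face_face_of[OF assms] maximal_face_nonempty[OF assms] by blast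
  qed
  then show ?thesis
    by (simp add: activation_fan_eq activation_cone_of_pattern outer_normal_cone_maximal_face[OF assms])
qed

end
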